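(* Consider the MPC closed-loop system described in the context. Assume that $A$ is Schur stable, i.e. all eigenvalues of $A$ have modulus strictly less than $1$. Assume also that $\mathbb{E}\bigl[\bar\varphi(\bar F\bar w)\bigr]=0$ for every initial condition. Then the closed loop satisfies $$\sup_{t\in\mathbb{N}_0}\mathbb{E}_{x_0}\bigl[\|x_t\|^2\bigr]<\infty.$$
   Context: **System.** Consider the discrete-time system $x_{t+1}=Ax_t+Bu_t+Fw_t+r$ for $t\in\mathbb{N}_0$. The data are: - $x_t\in\mathbb{R}^n$, $u_t\in\mathbb{R}^m$ and $w_t\in\mathbb{R}^n$; - known matrices $A$, $B$, $F$ and a known vector $r$; - a given initial state $x_0$; - i.i.d. noise vectors $w_t$, possibly with unbounded support, with mean $\mu_w$ and finite covariance $\Sigma_w$; - the input constraint $\|u_t\|_\infty\le U_{\max}$, where $U_{\max}>0$. **Stacked notation.** Fix a horizon $N\in\mathbb{N}$. Define - $\bar x=(x_0^\mathsf{T},\dots,x_N^\mathsf{T})^\mathsf{T}$, $\bar u=(u_0^\mathsf{T},\dots,u_{N-1}^\mathsf{T})^\mathsf{T}$, $\bar w=(w_0^\mathsf{T},\dots,w_{N-1}^\mathsf{T})^\mathsf{T}$, and $\bar r=(r^\mathsf{T},\dots,r^\mathsf{T})^\mathsf{T}\in\mathbb{R}^{Nn}$; - $\bar F=\operatorname{diag}(F,\dots,F)$ and $\bar A=(I,A^\mathsf{T},\dots,(A^N)^\mathsf{T})^\mathsf{T}$; - $\bar B$ is the block matrix with blocks $A^{k-1-j}B$ for $j<k$ and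 $0$ otherwise ($k=0,\dots,N$, $j=0,\dots,N-1$); - $\bar D$ is the block matrix with blocks $A^{k-1-j}$ for $j<k$ and $0$ otherwise. Then $\bar x=\bar Ax_0+\bar B\bar u+\bar D\bar F\bar w+\bar D\bar r$. Let $Q_0,\dots,Q_N$ and $R_0,\dots,R_{N-1}$ be symmetric positive definite, and set $\bar Q=\operatorname{diag}(Q_0,\dots,Q_N)$ and $\bar R=\operatorname{diag}(R_0,\dots,R_{N-1})$. **Saturated noise measurements.** Let $0<\phi_{\max}\le U_{\max}$, and let $\varphi_i^j:\mathbb{R}\to\mathbb{R}$ ($i=0,\dots,N-1$, $j=1,\dots,n$) be functions bounded in absolute value by $\phi_{\max}$. Set $\varphi_i(Fw_i)=(\varphi_i^1(F_1w_i),\dots,\varphi_i^n(F_nw_i))^\mathsf{T}$, with $F_j$ the $j$-th row of $F$, and $\bar\varphi(\bar F\bar w)=(\varphi_0(Fw_0)^\mathsf{T},\dots,\varphi_{N-1}(Fw_{N-1})^\mathsf{T})^\mathsf{T}$. **Finite-horizon problem.** For a given initial state $x$, the finite-horizon problem is to minimize $\mathbb{E}_{x}[\bar x^\mathsf{T}\bar Q\bar x+\bar u^\mathsf{T}\bar R\bar u]$, with $x_0=x$, over policies $\bar u=\bar G\bar\varphi(\bar F\bar w)+\bar d$. Here $\bar d\in\mathbb{R}^{Nm}$, and $\bar G\in\mathbb{R}^{Nm\times Nn}$ is strictly block lower triangular with $m\times n$ blocks. The constraint is $|\bar d_i|+\|\bar G_i\|_1\phi_{\max}\le U_{\max}$ for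 $i=1,\dots,Nm$, where $\bar G_i$ is the $i$-th row of $\bar G$; equivalently, $\|\bar Gv+\bar d\|_\infty\le U_{\max}$ whenever $\|v\|_\infty\le\phi_{\max}$. **MPC closed loop.** At each time $t$, the finite-horizon problem is solved with initial state $x_t$, giving an optimal solution $(\bar G^*,\bar d^* )$ that depends on $x_t$. Let $\bar d^*_{0|t}\in\mathbb{R}^m$ denote the first $m$ entries of $\bar d^*$. The control $u_t=\bar d^*_{0|t}$ is applied, so the closed loop is $$x_{t+1}=Ax_t+B\bar d^*_{0|t}+Fw_t+r,\qquad t\in\mathbb{N}_0.$$ *)

theory Defs
  imports "HOL-Probability.Probability"
begin

text \<open>Schur stability: every complex eigenvalue of the real matrix A has modulus < 1.\<close>
definition schur_stable :: "real^'n^'n \<Rightarrow> bool" where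
  "schur_stable A \<longleftrightarrow>
     (\<forall>(c::complex) (v::complex^'n). v \<noteq> 0 \<and>
        (\<chi> i j. complex_of_real (A$i$j)) *v v = c *s v \<longrightarrow> cmod c < 1)"

text \<open>Symmetric positive definite matrix.\<close>
definition sym_pos_def :: "real^'k^'k \<Rightarrow> bool" where
  "sym_pos_def Q \<longleftrightarrow> transpose Q = Q \<and> (\<forall>v. v \<noteq> 0 \<longrightarrow> v \<bullet> (Q *v v) > 0)"

text \<open>Saturated measurement vector: phi_vec phi i y = (phi_i^j(y_j))_j, applied to y = F w_i.\<close>
definition phi_vec :: "(nat \<Rightarrow> 'n \<Rightarrow> real \<Rightarrow> real) \<Rightarrow> nat \<Rightarrow> real^'n \<Rightarrow> real^'n" where
  "phi_vec phi i y = (\<chi> j. phi i j (y $ j))"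

text \<open>Block k of u-bar = G-bar phi-bar(F-bar w-bar) + d-bar (G-bar strictly block lower triangular,
  block (k,j) is G k j for j<k).\<close>
definition fh_input ::
  "real^'n^'n \<Rightarrow> (nat \<Rightarrow> 'n \<Rightarrow> real \<Rightarrow> real) \<Rightarrow> (nat \<Rightarrow> nat \<Rightarrow> real^'n^'m) \<Rightarrow>
   (nat \<Rightarrow> real^'m) \<Rightarrow> (nat \<Rightarrow> real^'n) \<Rightarrow> nat \<Rightarrow> real^'m" where
  "fh_input F phi G d ws k = d k + (\<Sum>j<k. G k j *v phi_vec phi j (F *v ws j))"

text \<open>Block k of x-bar (predicted state) under the policy, from initial state x.\<close>
primrec fh_state ::
  "real^'n^'n \<Rightarrow> real^'m^'n \<Rightarrow> real^'n^'n \<Rightarrow> real^'n \<Rightarrow> (nat \<Rightarrow> 'n \<Rightarrow> real \<Rightarrow> real) \<Rightarrow>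
   (nat \<Rightarrow> nat \<Rightarrow> real^'n^'m) \<Rightarrow> (nat \<Rightarrow> real^'m) \<Rightarrow> real^'n \<Rightarrow> (nat \<Rightarrow> real^'n) \<Rightarrow> nat \<Rightarrow> real^'n"
where
  "fh_state A B F r phi G d x ws 0 = x"
| "fh_state A B F r phi G d x ws (Suc k) =
     A *v fh_state A B F r phi G d x ws k + B *v fh_input F phi G d ws k + F *v ws k + r"

text \<open>Finite-horizon cost E_x[x-bar' Q-bar x-bar + u-bar' R-bar u-bar], the noise blocks
  w_0..w_{N-1} being i.i.d. with law D.\<close>
definition fh_cost ::
  "real^'n^'n \<Rightarrow> real^'m^'n \<Rightarrow> real^'n^'n \<Rightarrow> real^'n \<Rightarrow> (nat \<Rightarrow> real^'n^'n) \<Rightarrow> (nat \<Rightarrow> real^'m^'m) \<Rightarrow>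
   (nat \<Rightarrow> 'n \<Rightarrow> real \<Rightarrow> real) \<Rightarrow> nat \<Rightarrow> (real^'n) measure \<Rightarrow> real^'n \<Rightarrow>
   (nat \<Rightarrow> nat \<Rightarrow> real^'n^'m) \<Rightarrow> (nat \<Rightarrow> real^'m) \<Rightarrow> ennreal" where
  "fh_cost A B F r Q R phi N D x G d =
     (\<integral>\<^sup>+ ws. ennreal
        ((\<Sum>k\<le>N. fh_state A B F r phi G d x ws k \<bullet> (Q k *v fh_state A B F r phi G d x ws k))
       + (\<Sum>k<N. fh_input F phi G d ws k \<bullet> (R k *v fh_input F phi G d ws k)))
      \<partial>(PiM {..<N} (\<lambda>_. D)))"

text \<open>Constraint |d_i| + ||G_i||_1 phi_max <= U_max for every row i of (G-bar, d-bar).\<close>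
definition fh_admissible ::
  "real \<Rightarrow> real \<Rightarrow> nat \<Rightarrow> (nat \<Rightarrow> nat \<Rightarrow> real^'n^'m) \<Rightarrow> (nat \<Rightarrow> real^'m) \<Rightarrow> bool" where
  "fh_admissible phi_max U_max N G d \<longleftrightarrow>
     (\<forall>k<N. \<forall>i. \<bar>d k $ i\<bar> + (\<Sum>j<k. \<Sum>l\<in>UNIV. \<bar>G k j $ i $ l\<bar>) * phi_max \<le> U_max)"

definition fh_optimal ::
  "real^'n^'n \<Rightarrow> real^'m^'n \<Rightarrow> real^'n^'n \<Rightarrow> real^'n \<Rightarrow> (nat \<Rightarrow> real^'n^'n) \<Rightarrow> (nat \<Rightarrow> real^'m^'m) \<Rightarrow>
   (nat \<Rightarrow> 'n \<Rightarrow> real \<Rightarrow> real) \<Rightarrow> real \<Rightarrow> real \<Rightarrow> nat \<Rightarrow> (real^'n) measure \<Rightarrow> real^'n \<Rightarrow>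
   (nat \<Rightarrow> nat \<Rightarrow> real^'n^'m) \<Rightarrow> (nat \<Rightarrow> real^'m) \<Rightarrow> bool" where
  "fh_optimal A B F r Q R phi phi_max U_max N D x G d \<longleftrightarrow>
     fh_admissible phi_max U_max N G d \<and>
     (\<forall>G' d'. fh_admissible phi_max U_max N G' d' \<longrightarrow>
        fh_cost A B F r Q R phi N D x G d \<le> fh_cost A B F r Q R phi N D x G' d')"

text \<open>MPC closed loop x_{t+1} = A x_t + B pol(x_t) + F w_t + r, x_0 given.\<close>
primrec mpc_cl ::
  "real^'n^'n \<Rightarrow> real^'m^'n \<Rightarrow> real^'n^'n \<Rightarrow> real^'n \<Rightarrow> (real^'n \<Rightarrow> real^'m) \<Rightarrow> real^'n \<Rightarrow>
   (nat \<Rightarrow> 'a \<Rightarrow> real^'n) \<Rightarrow> nat \<Rightarrow> 'a \<Rightarrow> real^'n"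
where
  "mpc_cl A B F r pol x0 w 0 \<omega> = x0"
| "mpc_cl A B F r pol x0 w (Suc t) \<omega> =
     A *v mpc_cl A B F r pol x0 w t \<omega> + B *v pol (mpc_cl A B F r pol x0 w t \<omega>) + F *v w t \<omega> + r"

end

(* The first block of an admissible policy contains no feedback (the gain is strictly block
   lower triangular), so the input applied by MPC satisfies |u_t| <= U_max componentwise,
   whatever the state.  The closed loop is therefore a linear recursion x_{t+1} = A x_t + b_t
   with ||b_t|| <= beta + K ||w_t||.  Schur stability gives ||A^k v|| <= C rho^k ||v|| for some
   rho < 1: the powers of A/rho, whose spectral radius is below 1, are bounded by the Jordan
   normal form.  Variation of constants and Cauchy-Schwarz with the geometric weights
   rho^(t-1-s) then bound E||x_t||^2 by an affine function of E||w_0||^2, uniformly in t. *)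

theory Submission
  imports Defs "Jordan_Normal_Form.Spectral_Radius"
begin

no_notation Matrix.vec_index (infixl "$" 100)
no_notation Matrix.scalar_prod (infix "\<bullet>" 70)

section \<open>Powers of complex matrices with spectral radius below a bound\<close>

lemma smult_mat_mult_vec:
  "v \<in> carrier_vec (dim_col A) \<Longrightarrow> (a \<cdot>\<^sub>m A) *\<^sub>v v = (a :: 'a :: comm_semiring_0) \<cdot>\<^sub>v (A *\<^sub>v v)"
  by (intro eq_vecI) (auto simp: scalar_prod_def sum_distrib_left mult.assoc)

lemma pow_smult_mat:
  assumes "A \<in> carrier_mat n n"
  shows "(a \<cdot>\<^sub>m A) ^\<^sub>m k = (a :: 'a :: comm_semiring_1) ^ k \<cdot>\<^sub>m A ^\<^sub>m k"
proof (induction k)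
  case 0
  show ?case using assms by auto
next
  case (Suc k)
  have "A ^\<^sub>m k \<in> carrier_mat n n" using assms by (rule pow_carrier_mat)
  then show ?case using assms Suc
    by (auto simp: mult_smult_assoc_mat mult_smult_distrib scalar_prod_def sum_distrib_left ac_simps)
qed

lemma norm_bound_smult_mat:
  "norm_bound A c \<Longrightarrow> norm_bound (a \<cdot>\<^sub>m A) (norm (a :: 'a :: real_normed_field) * c)"
  unfolding norm_bound_def by (auto simp: norm_mult intro: mult_left_mono)

lemma norm_bound_nonneg: "norm_bound A c \<Longrightarrow> 0 < dim_row A \<Longrightarrow> 0 < dim_col A \<Longrightarrow> 0 \<le> c"
  unfolding norm_bound_def by (meson norm_ge_zero order_trans)

lemma spectral_radius_less_imp_norm_bound_pow:
  fixes A :: "complex mat"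
  assumes A: "A \<in> carrier_mat n n" and \<rho>: "0 < \<rho>" and sr: "spectral_radius A < \<rho>"
  shows "\<exists>c. \<forall>k. norm_bound (A ^\<^sub>m k) (c * \<rho> ^ k)"
proof (cases "n = 0")
  case True
  then show ?thesis using A by (auto simp: norm_bound_def)
next
  case False
  \<comment> \<open>The spectral radius of \<open>A / \<rho>\<close> is below 1, so its powers are bounded.\<close>
  define B where "B = complex_of_real (1 / \<rho>) \<cdot>\<^sub>m A"
  have B: "B \<in> carrier_mat n n" using A by (simp add: B_def)
  have A_eq: "A = complex_of_real \<rho> \<cdot>\<^sub>m B"
    using A \<rho> by (auto simp: B_def)
  have "norm c < 1" if c: "c \<in> spectrum B" for c
  proof -
    obtain v where v: "eigenvector B v c"
      using c by (auto simp: spectrum_def eigenvalue_def)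
    then have "A *\<^sub>v v = (complex_of_real \<rho> * c) \<cdot>\<^sub>v v"
      using B by (simp add: eigenvector_def A_eq smult_mat_mult_vec smult_smult_assoc)
    then have "eigenvector A v (complex_of_real \<rho> * c)"
      using v A B by (simp add: eigenvector_def)
    then have "norm (complex_of_real \<rho> * c) \<le> spectral_radius A"
      using spectral_radius_mem_max(2)[OF A] False
      unfolding spectrum_def eigenvalue_def by blast
    then have "\<rho> * norm c \<le> spectral_radius A" using \<rho> by (simp add: norm_mult)
    then have "\<rho> * norm c < \<rho> * 1" using sr by linarith
    then show ?thesis using \<rho> by (simp only: mult_less_cancel_left_pos)
  qed
  then have "spectral_radius B < 1"
    using spectral_radius_mem_max(1)[OF B] False by auto
  then obtain c where c: "\<And>k. norm_bound (B ^\<^sub>m k) c"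
    using spectral_radius_jnf_norm_bound_less_1_upper_triangular[OF B] by blast
  have "norm_bound (A ^\<^sub>m k) (c * \<rho> ^ k)" for k
    using norm_bound_smult_mat[OF c[of k], of "complex_of_real \<rho> ^ k"] \<rho>
    by (simp add: A_eq pow_smult_mat[OF B] norm_power mult.commute)
  then show ?thesis by blast
qed

section \<open>Geometric decay of the powers of a Schur-stable matrix\<close>

(* A fixed enumeration of the index type identifies real^'n^'n with square matrices of the
   Jordan normal form library. *)
definition to_index :: "'n::finite \<Rightarrow> nat" where
  "to_index = (SOME h. bij_betw h UNIV {..<CARD('n)})"

definition from_index :: "nat \<Rightarrow> 'n::finite" where
  "from_index = inv_into UNIV to_index"

lemma bij_betw_to_index: "bij_betw (to_index :: 'n::finite \<Rightarrow> nat) UNIV {..<CARD('n)}"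
proof -
  have "\<exists>h. bij_betw h (UNIV :: 'n set) {..<CARD('n)}"
    using ex_bij_betw_finite_nat[of "UNIV :: 'n set"] by (simp add: atLeast0LessThan)
  then show ?thesis
    unfolding to_index_def by (rule someI_ex)
qed

lemma to_index_less [simp]: "to_index (i :: 'n::finite) < CARD('n)"
  using bij_betw_imp_surj_on[OF bij_betw_to_index] by blast

lemma from_index_to_index [simp]: "from_index (to_index i) = i"
  unfolding from_index_def
  by (rule inv_into_f_f[OF bij_betw_imp_inj_on[OF bij_betw_to_index]]) simp

lemma to_index_from_index [simp]: "k < CARD('n::finite) \<Longrightarrow> to_index (from_index k :: 'n) = k"
  unfolding from_index_def
  by (rule f_inv_into_f) (use bij_betw_imp_surj_on[OF bij_betw_to_index] in auto)

lemma sum_from_index: "(\<Sum>k<CARD('n::finite). g (from_index k :: 'n)) = (\<Sum>j\<in>UNIV. g j)"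
  using sum.reindex_bij_betw[OF bij_betw_to_index[where 'n='n], of "\<lambda>k. g (from_index k)"] by simp

definition cmat_of :: "real^'n^'n \<Rightarrow> complex mat" where
  "cmat_of X = mat CARD('n) CARD('n) (\<lambda>(i, j). complex_of_real (X $ from_index i $ from_index j))"

definition cvec_of :: "real^'n \<Rightarrow> complex Matrix.vec" where
  "cvec_of v = Matrix.vec CARD('n) (\<lambda>i. complex_of_real (v $ from_index i))"

lemma cmat_of_carrier [simp]: "cmat_of (X :: real^'n^'n) \<in> carrier_mat CARD('n) CARD('n)"
  by (simp add: cmat_of_def)

lemma cvec_of_carrier [simp]: "cvec_of (v :: real^'n) \<in> carrier_vec CARD('n)"
  by (simp add: cvec_of_def)

lemma cmat_of_mult_cvec_of:
  fixes X :: "real^'n^'n"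
  shows "cmat_of X *\<^sub>v cvec_of v = cvec_of (X *v v)"
proof (rule eq_vecI)
  fix i assume "i < dim_vec (cvec_of (X *v v))"
  then have i: "i < CARD('n)" by (simp add: cvec_of_def)
  have "vec_index (cmat_of X *\<^sub>v cvec_of v) i
      = (\<Sum>k<CARD('n). complex_of_real (X $ from_index i $ from_index k) * complex_of_real (v $ from_index k))"
    using i by (simp add: cmat_of_def cvec_of_def scalar_prod_def atLeast0LessThan)
  also have "\<dots> = (\<Sum>j\<in>UNIV. complex_of_real (X $ from_index i $ j) * complex_of_real (v $ j))"
    by (rule sum_from_index)
  also have "\<dots> = vec_index (cvec_of (X *v v)) i"
    using i by (simp add: cvec_of_def matrix_vector_mult_def)
  finally show "vec_index (cmat_of X *\<^sub>v cvec_of v) i = vec_index (cvec_of (X *v v)) i" .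
qed (simp add: cmat_of_def cvec_of_def)

lemma cmat_of_pow_mult_cvec_of:
  fixes X :: "real^'n^'n"
  shows "cmat_of X ^\<^sub>m k *\<^sub>v cvec_of v = cvec_of (((*v) X ^^ k) v)"
proof (induction k arbitrary: v)
  case 0
  show ?case by (simp add: cmat_of_def)
next
  case (Suc k)
  have "cmat_of X ^\<^sub>m Suc k *\<^sub>v cvec_of v = cmat_of X ^\<^sub>m k *\<^sub>v (cmat_of X *\<^sub>v cvec_of v)"
    by (simp add: assoc_mult_mat_vec[OF pow_carrier_mat[OF cmat_of_carrier] cmat_of_carrier cvec_of_carrier])
  also have "\<dots> = cvec_of (((*v) X ^^ k) (X *v v))"
    by (simp add: cmat_of_mult_cvec_of Suc)
  finally show ?case
    by (simp only: funpow_Suc_right comp_def)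
qed

lemma eigenvector_cmat_of:
  fixes X :: "real^'n^'n"
  assumes "eigenvector (cmat_of X) v c"
  shows "\<exists>u :: complex^'n. u \<noteq> 0 \<and> (\<chi> i j. complex_of_real (X $ i $ j)) *v u = c *s u"
proof (intro exI conjI)
  have v: "v \<in> carrier_vec CARD('n)" "v \<noteq> 0\<^sub>v CARD('n)" "cmat_of X *\<^sub>v v = c \<cdot>\<^sub>v v"
    using assms by (auto simp: eigenvector_def cmat_of_def)
  define u :: "complex^'n" where "u = (\<chi> i. vec_index v (to_index i))"
  obtain k where k: "k < CARD('n)" "vec_index v k \<noteq> 0"
    using v(1,2) by (metis carrier_vecD eq_vecI index_zero_vec)
  then have "u $ from_index k \<noteq> 0" by (simp add: u_def)
  then show "u \<noteq> 0" by auto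
  have "((\<chi> i j. complex_of_real (X $ i $ j)) *v u) $ i = (c *s u) $ i" for i
  proof -
    have "((\<chi> i j. complex_of_real (X $ i $ j)) *v u) $ i
        = (\<Sum>j\<in>UNIV. complex_of_real (X $ i $ j) * vec_index v (to_index j))"
      by (simp add: matrix_vector_mult_def u_def)
    also have "\<dots> = (\<Sum>k<CARD('n). complex_of_real (X $ i $ from_index k) * vec_index v k)"
      by (simp add: sum_from_index[symmetric])
    also have "\<dots> = vec_index (cmat_of X *\<^sub>v v) (to_index i)"
      using v(1) by (simp add: cmat_of_def scalar_prod_def atLeast0LessThan)
    also have "\<dots> = (c *s u) $ i"
      using v by (simp add: u_def)
    finally show ?thesis .
  qed
  then show "(\<chi> i j. complex_of_real (X $ i $ j)) *v u = c *s u"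
    by (simp add: Finite_Cartesian_Product.vec_eq_iff)
qed

lemma spectral_radius_cmat_of_less_1:
  assumes "schur_stable A"
  shows "spectral_radius (cmat_of A) < 1"
proof -
  obtain c where c: "c \<in> spectrum (cmat_of A)" and sr: "spectral_radius (cmat_of A) = norm c"
    using spectral_radius_mem_max(1)[OF cmat_of_carrier] by auto
  then obtain v where "eigenvector (cmat_of A) v c"
    by (auto simp: spectrum_def eigenvalue_def)
  then have "norm c < 1"
    using assms eigenvector_cmat_of unfolding schur_stable_def by blast
  then show ?thesis
    using sr by simp
qed

lemma norm_le_of_norm_bound:
  fixes v y :: "real^'n" and c :: real
  assumes M: "M \<in> carrier_mat CARD('n) CARD('n)" and c: "norm_bound M c"
    and y: "M *\<^sub>v cvec_of v = cvec_of y"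
  shows "norm y \<le> CARD('n) * CARD('n) * c * norm v"
proof -
  have c0: "0 \<le> c" using norm_bound_nonneg[OF c] M by simp
  have component: "\<bar>y $ j\<bar> \<le> CARD('n) * c * norm v" for j
  proof -
    have "complex_of_real (y $ j) = vec_index (cvec_of y) (to_index j)"
      by (simp add: cvec_of_def)
    also have "\<dots> = vec_index (M *\<^sub>v cvec_of v) (to_index j)"
      by (simp only: y)
    also have "\<dots> = (\<Sum>l<CARD('n). M $$ (to_index j, l) * complex_of_real (v $ from_index l))"
      using M by (simp add: cvec_of_def scalar_prod_def atLeast0LessThan)
    finally have eq: "complex_of_real (y $ j)
        = (\<Sum>l<CARD('n). M $$ (to_index j, l) * complex_of_real (v $ from_index l))" .
    have "\<bar>y $ j\<bar> = norm (\<Sum>l<CARD('n). M $$ (to_index j, l) * complex_of_real (v $ from_index l))"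
      by (subst eq[symmetric]) simp
    also have "\<dots> \<le> (\<Sum>l<CARD('n). c * norm v)"
    proof (rule sum_norm_le)
      fix l assume "l \<in> {..<CARD('n)}"
      then have "norm (M $$ (to_index j, l)) \<le> c"
        using c M unfolding norm_bound_def by auto
      then have "norm (M $$ (to_index j, l)) * \<bar>v $ from_index l\<bar> \<le> c * norm v"
        by (rule mult_mono) (simp_all add: c0 component_le_norm_cart)
      then show "norm (M $$ (to_index j, l) * complex_of_real (v $ from_index l)) \<le> c * norm v"
        by (simp add: norm_mult)
    qed
    finally show ?thesis by simp
  qed
  have "norm y \<le> (\<Sum>j\<in>UNIV. \<bar>y $ j\<bar>)" by (rule norm_le_l1_cart)
  also have "\<dots> \<le> (\<Sum>j\<in>(UNIV :: 'n set). CARD('n) * c * norm v)" by (rule sum_mono) (rule component)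
  finally show ?thesis by simp
qed

lemma schur_stable_funpow_decay:
  fixes A :: "real^'n^'n"
  assumes "schur_stable A"
  obtains C \<rho> where "0 \<le> C" "0 < \<rho>" "\<rho> < 1" "\<And>k v. norm (((*v) A ^^ k) v) \<le> C * \<rho> ^ k * norm v"
proof -
  define s where "s = spectral_radius (cmat_of A)"
  have "s \<in> norm ` spectrum (cmat_of A)"
    unfolding s_def by (rule spectral_radius_mem_max(1)[OF cmat_of_carrier]) simp
  then have s: "0 \<le> s" "s < 1"
    using spectral_radius_cmat_of_less_1[OF assms] by (auto simp: s_def)
  define \<rho> where "\<rho> = (s + 1) / 2"
  have \<rho>: "0 < \<rho>" "\<rho> < 1" "s < \<rho>" using s by (auto simp: \<rho>_def)
  obtain c where c: "\<And>k. norm_bound (cmat_of A ^\<^sub>m k) (c * \<rho> ^ k)"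
    using spectral_radius_less_imp_norm_bound_pow[OF cmat_of_carrier \<rho>(1)] \<rho>(3) s_def by blast
  have "0 \<le> c" using norm_bound_nonneg[OF c[of 0]] by (simp add: cmat_of_def)
  show ?thesis
  proof
    show "0 \<le> CARD('n) * CARD('n) * c" using \<open>0 \<le> c\<close> by simp
    show "norm (((*v) A ^^ k) v) \<le> CARD('n) * CARD('n) * c * \<rho> ^ k * norm v" for k v
      using norm_le_of_norm_bound[OF pow_carrier_mat[OF cmat_of_carrier] c cmat_of_pow_mult_cvec_of]
      by (simp add: mult.assoc)
  qed (use \<rho> in auto)
qed

section \<open>Stable linear recursions driven by noise\<close>

lemma linear_recurrence_closed_form:
  fixes f :: "'v::real_vector \<Rightarrow> 'v"
  assumes f: "linear f" and rec: "\<And>t. x (Suc t) = f (x t) + b t"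
  shows "x t = (f ^^ t) (x 0) + (\<Sum>s<t. (f ^^ (t - Suc s)) (b s))"
proof (induction t)
  case 0
  show ?case by simp
next
  case (Suc t)
  have "(\<Sum>s<t. f ((f ^^ (t - Suc s)) (b s))) = (\<Sum>s<t. (f ^^ (Suc t - Suc s)) (b s))"
  proof (rule sum.cong)
    fix s assume "s \<in> {..<t}"
    then have "Suc t - Suc s = Suc (t - Suc s)" by simp
    then show "f ((f ^^ (t - Suc s)) (b s)) = (f ^^ (Suc t - Suc s)) (b s)" by simp
  qed simp
  then show ?case
    using Suc by (simp add: rec real_vector.linear_add[OF f] real_vector.linear_sum[OF f] add.assoc)
qed

lemma norm_linear_recurrence_le:
  fixes f :: "'v::real_normed_vector \<Rightarrow> 'v"
  assumes f: "linear f" and rec: "\<And>t. x (Suc t) = f (x t) + b t"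
    and decay: "\<And>k v. norm ((f ^^ k) v) \<le> C * \<rho> ^ k * norm v"
  shows "norm (x t) \<le> C * \<rho> ^ t * norm (x 0) + C * (\<Sum>s<t. \<rho> ^ (t - Suc s) * norm (b s))"
proof -
  have "norm (x t) \<le> norm ((f ^^ t) (x 0)) + (\<Sum>s<t. norm ((f ^^ (t - Suc s)) (b s)))"
    unfolding linear_recurrence_closed_form[where x=x and b=b, OF f rec, of t]
    by (rule order_trans[OF norm_triangle_ineq add_left_mono[OF norm_sum]])
  also have "\<dots> \<le> C * \<rho> ^ t * norm (x 0) + (\<Sum>s<t. C * \<rho> ^ (t - Suc s) * norm (b s))"
    by (intro add_mono sum_mono decay)
  finally show ?thesis by (simp add: sum_distrib_left mult.assoc)
qed

lemma sum_power_diff_le: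
  fixes \<rho> :: real
  assumes "0 \<le> \<rho>" "\<rho> < 1"
  shows "(\<Sum>s<t. \<rho> ^ (t - Suc s)) \<le> 1 / (1 - \<rho>)"
proof -
  have "(\<Sum>s<t. \<rho> ^ (t - Suc s)) = (\<Sum>i<t. \<rho> ^ i)" by (rule sum.nat_diff_reindex)
  also have "\<dots> = (1 - \<rho> ^ t) / (1 - \<rho>)" using assms by (simp add: sum_gp_strict)
  also have "\<dots> \<le> 1 / (1 - \<rho>)" using assms by (simp add: divide_right_mono)
  finally show ?thesis .
qed

lemma square_sum_weighted_le:
  fixes a y :: "'b \<Rightarrow> real"
  assumes "\<And>s. 0 \<le> a s"
  shows "(\<Sum>s\<in>I. a s * y s)\<^sup>2 \<le> (\<Sum>s\<in>I. a s) * (\<Sum>s\<in>I. a s * (y s)\<^sup>2)"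
  using Cauchy_Schwarz_ineq_sum[of "\<lambda>s. sqrt (a s)" "\<lambda>s. sqrt (a s) * y s" I] assms
  by (simp add: power_mult_distrib mult.assoc[symmetric])

lemma norm_linear_recurrence_square_le:
  fixes f :: "'v::real_normed_vector \<Rightarrow> 'v"
  assumes f: "linear f" and rec: "\<And>t. x (Suc t) = f (x t) + b t"
    and decay: "\<And>k v. norm ((f ^^ k) v) \<le> C * \<rho> ^ k * norm v"
    and C: "0 \<le> C" and \<rho>: "0 \<le> \<rho>" "\<rho> < 1"
    and b: "\<And>t. norm (b t) \<le> \<beta> + K * z t"
  shows "(norm (x t))\<^sup>2 \<le> 2 * C\<^sup>2 * (norm (x 0))\<^sup>2 + 4 * C\<^sup>2 * \<beta>\<^sup>2 / (1 - \<rho>)\<^sup>2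
           + 4 * C\<^sup>2 * K\<^sup>2 / (1 - \<rho>) * (\<Sum>s<t. \<rho> ^ (t - Suc s) * (z s)\<^sup>2)"
proof -
  define a where "a s = \<rho> ^ (t - Suc s)" for s
  define S where "S = 1 / (1 - \<rho>)"
  have a: "0 \<le> a s" for s using \<rho> by (simp add: a_def)
  have S: "(\<Sum>s<t. a s) \<le> S" "0 \<le> S"
    using sum_power_diff_le[OF \<rho>] \<rho> by (simp_all add: a_def S_def)
  have sq_sum: "(p + q)\<^sup>2 \<le> 2 * p\<^sup>2 + 2 * q\<^sup>2" for p q :: real
    using zero_le_power2[of "p - q"] by (simp add: power2_eq_square algebra_simps)
  have b_sq: "(norm (b s))\<^sup>2 \<le> 2 * \<beta>\<^sup>2 + 2 * K\<^sup>2 * (z s)\<^sup>2" for s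
    using power_mono[OF b[of s] norm_ge_zero, of 2] sq_sum[of \<beta> "K * z s"]
    by (simp add: power_mult_distrib)
  have "C * \<rho> ^ t * norm (x 0) \<le> C * 1 * norm (x 0)"
    using \<rho> C by (intro mult_right_mono mult_left_mono power_le_one) auto
  then have "norm (x t) \<le> C * norm (x 0) + C * (\<Sum>s<t. a s * norm (b s))"
    using norm_linear_recurrence_le[where x=x and b=b, OF f rec decay, of t]
    unfolding a_def by linarith
  then have "(norm (x t))\<^sup>2 \<le> (C * norm (x 0) + C * (\<Sum>s<t. a s * norm (b s)))\<^sup>2"
    by (rule power_mono[OF _ norm_ge_zero])
  also have "\<dots> \<le> 2 * C\<^sup>2 * (norm (x 0))\<^sup>2 + 2 * C\<^sup>2 * (\<Sum>s<t. a s * norm (b s))\<^sup>2"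
    using sq_sum[of "C * norm (x 0)" "C * (\<Sum>s<t. a s * norm (b s))"]
    by (simp add: power_mult_distrib mult.assoc)
  finally have x_sq: "(norm (x t))\<^sup>2 \<le> 2 * C\<^sup>2 * (norm (x 0))\<^sup>2 + 2 * C\<^sup>2 * (\<Sum>s<t. a s * norm (b s))\<^sup>2" .
  have "(\<Sum>s<t. a s * norm (b s))\<^sup>2 \<le> (\<Sum>s<t. a s) * (\<Sum>s<t. a s * (norm (b s))\<^sup>2)"
    by (rule square_sum_weighted_le[OF a])
  also have "\<dots> \<le> S * (\<Sum>s<t. a s * (2 * \<beta>\<^sup>2 + 2 * K\<^sup>2 * (z s)\<^sup>2))"
    using S a b_sq by (intro mult_mono sum_mono mult_left_mono sum_nonneg) auto
  also have "\<dots> = 2 * \<beta>\<^sup>2 * S * (\<Sum>s<t. a s) + 2 * K\<^sup>2 * S * (\<Sum>s<t. a s * (z s)\<^sup>2)"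
    by (simp add: algebra_simps sum.distrib sum_distrib_left sum_distrib_right)
  also have "\<dots> \<le> 2 * \<beta>\<^sup>2 * S * S + 2 * K\<^sup>2 * S * (\<Sum>s<t. a s * (z s)\<^sup>2)"
    using S by (simp add: mult_left_mono)
  finally have "2 * C\<^sup>2 * (\<Sum>s<t. a s * norm (b s))\<^sup>2
      \<le> 2 * C\<^sup>2 * (2 * \<beta>\<^sup>2 * S * S + 2 * K\<^sup>2 * S * (\<Sum>s<t. a s * (z s)\<^sup>2))"
    by (rule mult_left_mono) simp
  moreover have "2 * C\<^sup>2 * (2 * \<beta>\<^sup>2 * S * S + 2 * K\<^sup>2 * S * (\<Sum>s<t. a s * (z s)\<^sup>2))
      = 4 * C\<^sup>2 * \<beta>\<^sup>2 / (1 - \<rho>)\<^sup>2 + 4 * C\<^sup>2 * K\<^sup>2 / (1 - \<rho>) * (\<Sum>s<t. \<rho> ^ (t - Suc s) * (z s)\<^sup>2)"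
    using \<rho>(2) by (simp add: a_def S_def power2_eq_square field_simps)
  ultimately show ?thesis
    using x_sq by linarith
qed

lemma identically_distributed_integral:
  fixes g :: "'b::topological_space \<Rightarrow> real"
  assumes X: "X \<in> borel_measurable M" and Y: "Y \<in> borel_measurable M"
    and XY: "distr M borel X = distr M borel Y"
    and g: "g \<in> borel_measurable borel" and int: "integrable M (\<lambda>\<omega>. g (Y \<omega>))"
  shows "integrable M (\<lambda>\<omega>. g (X \<omega>))" and "(\<integral>\<omega>. g (X \<omega>) \<partial>M) = (\<integral>\<omega>. g (Y \<omega>) \<partial>M)"
  using int integrable_distr_eq[OF X g] integrable_distr_eq[OF Y g]
    integral_distr[OF X g] integral_distr[OF Y g] XY by simp_all

lemma second_moment_linear_recurrence_bounded:
  fixes f :: "'v::real_normed_vector \<Rightarrow> 'v" and X b :: "nat \<Rightarrow> 'a \<Rightarrow> 'v"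
    and w :: "nat \<Rightarrow> 'a \<Rightarrow> 'w::real_normed_vector"
  assumes M: "prob_space M" and f: "linear f"
    and decay: "\<And>k v. norm ((f ^^ k) v) \<le> C * \<rho> ^ k * norm v"
    and C: "0 \<le> C" and \<rho>: "0 \<le> \<rho>" "\<rho> < 1"
    and rec: "\<And>t \<omega>. X (Suc t) \<omega> = f (X t \<omega>) + b t \<omega>" and init: "\<And>\<omega>. X 0 \<omega> = x0"
    and b: "\<And>t \<omega>. norm (b t \<omega>) \<le> \<beta> + K * norm (w t \<omega>)"
    and w: "\<And>t. w t \<in> borel_measurable M"
    and w_distr: "\<And>t. distr M borel (w t) = distr M borel (w 0)"
    and w_moment: "integrable M (\<lambda>\<omega>. (norm (w 0 \<omega>))\<^sup>2)"
  shows "(SUP t. \<integral>\<^sup>+ \<omega>. ennreal ((norm (X t \<omega>))\<^sup>2) \<partial>M) < \<infinity>"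
proof -
  interpret prob_space M by (fact M)
  define m where "m = (\<integral>\<omega>. (norm (w 0 \<omega>))\<^sup>2 \<partial>M)"
  define c0 where "c0 = 2 * C\<^sup>2 * (norm x0)\<^sup>2 + 4 * C\<^sup>2 * \<beta>\<^sup>2 / (1 - \<rho>)\<^sup>2"
  define c1 where "c1 = 4 * C\<^sup>2 * K\<^sup>2 / (1 - \<rho>)"
  \<comment> \<open>\<open>X t\<close> need not be measurable; its second moment is bounded via the integrable \<open>H t\<close>.\<close>
  define H where "H t \<omega> = c0 + c1 * (\<Sum>s<t. \<rho> ^ (t - Suc s) * (norm (w s \<omega>))\<^sup>2)" for t \<omega>
  have norm_sq: "(\<lambda>x. (norm x)\<^sup>2) \<in> borel_measurable (borel :: 'w measure)"
    by measurable
  have w_int: "integrable M (\<lambda>\<omega>. (norm (w s \<omega>))\<^sup>2)" for s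
    by (rule identically_distributed_integral(1)[OF w w w_distr norm_sq w_moment])
  have w_m: "(\<integral>\<omega>. (norm (w s \<omega>))\<^sup>2 \<partial>M) = m" for s
    unfolding m_def by (rule identically_distributed_integral(2)[OF w w w_distr norm_sq w_moment])
  have XH: "(norm (X t \<omega>))\<^sup>2 \<le> H t \<omega>" for t \<omega>
    using norm_linear_recurrence_square_le[where x="\<lambda>t. X t \<omega>" and b="\<lambda>t. b t \<omega>"
        and z="\<lambda>t. norm (w t \<omega>)", OF f rec decay C \<rho> b]
    by (simp add: H_def c0_def c1_def init)
  have H_nonneg: "0 \<le> H t \<omega>" for t \<omega>
    by (rule order_trans[OF zero_le_power2 XH])
  have H_int: "integrable M (H t)" for t
    unfolding H_def using w_int by auto
  have c1: "0 \<le> c1" and m: "0 \<le> m" using \<rho> by (simp_all add: c1_def m_def)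
  have bound: "(\<integral>\<^sup>+ \<omega>. ennreal ((norm (X t \<omega>))\<^sup>2) \<partial>M) \<le> ennreal (c0 + c1 * m / (1 - \<rho>))" for t
  proof -
    have "(\<integral>\<omega>. H t \<omega> \<partial>M) = c0 + c1 * ((\<Sum>s<t. \<rho> ^ (t - Suc s)) * m)"
      using w_int by (simp add: H_def w_m sum_distrib_right prob_space)
    also have "\<dots> \<le> c0 + c1 * (1 / (1 - \<rho>) * m)"
      using sum_power_diff_le[OF \<rho>] c1 m by (intro add_left_mono mult_left_mono mult_right_mono) auto
    finally have H_le: "(\<integral>\<omega>. H t \<omega> \<partial>M) \<le> c0 + c1 * m / (1 - \<rho>)"
      by simp
    have "(\<integral>\<^sup>+ \<omega>. ennreal ((norm (X t \<omega>))\<^sup>2) \<partial>M) \<le> (\<integral>\<^sup>+ \<omega>. ennreal (H t \<omega>) \<partial>M)"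
      by (intro nn_integral_mono ennreal_leI XH)
    also have "\<dots> = ennreal (\<integral>\<omega>. H t \<omega> \<partial>M)"
      by (rule nn_integral_eq_integral[OF H_int]) (simp add: H_nonneg)
    also have "\<dots> \<le> ennreal (c0 + c1 * m / (1 - \<rho>))"
      by (rule ennreal_leI[OF H_le])
    finally show ?thesis .
  qed
  have "(SUP t. \<integral>\<^sup>+ \<omega>. ennreal ((norm (X t \<omega>))\<^sup>2) \<partial>M) \<le> ennreal (c0 + c1 * m / (1 - \<rho>))"
    by (rule SUP_least) (rule bound)
  then show ?thesis
    unfolding infinity_ennreal_def using ennreal_less_top by (rule le_less_trans)
qed

section \<open>The MPC closed loop\<close>

lemma fh_admissible_first_input_norm_le:
  fixes d :: "nat \<Rightarrow> real^'m" and U_max :: real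
  assumes "fh_admissible phi_max U_max N G d" and "0 < N"
  shows "norm (d 0) \<le> CARD('m) * U_max"
proof -
  have "\<bar>d 0 $ i\<bar> \<le> U_max" for i
    using spec[OF assms(1)[unfolded fh_admissible_def], of 0] assms(2) by simp
  then have "(\<Sum>i\<in>UNIV. \<bar>d 0 $ i\<bar>) \<le> (\<Sum>i\<in>(UNIV :: 'm set). U_max)"
    by (rule sum_mono)
  then show ?thesis
    using norm_le_l1_cart[of "d 0"] by simp
qed

lemma norm_affine_input_le:
  fixes B :: "real^'m^'n" and F :: "real^'k^'n"
  assumes "norm u \<le> u_max"
  shows "norm (B *v u + F *v v + r) \<le> (onorm ((*v) B) * u_max + norm r) + onorm ((*v) F) * norm v"
proof -
  have "norm (B *v u + F *v v + r) \<le> norm (B *v u) + norm (F *v v) + norm r"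
    by (rule order_trans[OF norm_triangle_ineq add_right_mono[OF norm_triangle_ineq]])
  moreover have "norm (B *v u) \<le> onorm ((*v) B) * u_max"
    using onorm[OF matrix_vector_mul_bounded_linear, of B u]
      mult_left_mono[OF assms onorm_pos_le[OF matrix_vector_mul_bounded_linear]]
    by (rule order_trans)
  moreover have "norm (F *v v) \<le> onorm ((*v) F) * norm v"
    by (rule onorm[OF matrix_vector_mul_bounded_linear])
  ultimately show ?thesis
    by linarith
qed

lemma mpc_cl_second_moment_bounded:
  fixes A :: "real^'n^'n" and B :: "real^'m^'n" and F :: "real^'n^'n"
    and w :: "nat \<Rightarrow> 'a \<Rightarrow> real^'n"
  assumes M: "prob_space M" and A: "schur_stable A" and pol: "\<And>x. norm (pol x) \<le> u_max"
    and w: "\<And>t. w t \<in> borel_measurable M"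
    and w_distr: "\<And>t. distr M borel (w t) = distr M borel (w 0)"
    and w_moment: "integrable M (\<lambda>\<omega>. (norm (w 0 \<omega>))\<^sup>2)"
  shows "(SUP t. \<integral>\<^sup>+ \<omega>. ennreal ((norm (mpc_cl A B F r pol x0 w t \<omega>))\<^sup>2) \<partial>M) < \<infinity>"
proof -
  obtain C \<rho> where C: "0 \<le> C" and \<rho>: "0 < \<rho>" "\<rho> < 1"
    and decay: "\<And>k v. norm (((*v) A ^^ k) v) \<le> C * \<rho> ^ k * norm v"
    using schur_stable_funpow_decay[OF A] by blast
  let ?X = "mpc_cl A B F r pol x0 w"
  show ?thesis
  proof (rule second_moment_linear_recurrence_bounded[where X="?X" and w=w
        and b="\<lambda>t \<omega>. B *v pol (?X t \<omega>) + F *v w t \<omega> + r"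
        and \<beta>="onorm ((*v) B) * u_max + norm r" and K="onorm ((*v) F)",
        OF M matrix_vector_mul_linear decay C less_imp_le[OF \<rho>(1)] \<rho>(2) _ _ _ w w_distr w_moment])
    show "?X (Suc t) \<omega> = A *v ?X t \<omega> + (B *v pol (?X t \<omega>) + F *v w t \<omega> + r)" for t \<omega>
      by (simp add: add.assoc)
    show "?X 0 \<omega> = x0" for \<omega>
      by simp
    show "norm (B *v pol (?X t \<omega>) + F *v w t \<omega> + r)
        \<le> onorm ((*v) B) * u_max + norm r + onorm ((*v) F) * norm (w t \<omega>)" for t \<omega>
      by (rule norm_affine_input_le[OF pol])
  qed
qed

theorem proposition3:
  fixes M :: "'a measure"
    and A :: "real^'n^'n" and B :: "real^'m^'n" and F :: "real^'n^'n" and r :: "real^'n"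
    and x0 :: "real^'n"
    and w :: "nat \<Rightarrow> 'a \<Rightarrow> real^'n"
    and U_max phi_max :: real and N :: nat
    and Q :: "nat \<Rightarrow> real^'n^'n" and R :: "nat \<Rightarrow> real^'m^'m"
    and phi :: "nat \<Rightarrow> 'n \<Rightarrow> real \<Rightarrow> real"
    and opt :: "real^'n \<Rightarrow> (nat \<Rightarrow> nat \<Rightarrow> real^'n^'m) \<times> (nat \<Rightarrow> real^'m)"
  assumes "prob_space M"
    and "prob_space.indep_vars M (\<lambda>_. borel) w UNIV"
    and "\<forall>t. distr M borel (w t) = distr M borel (w 0)"
    and "integrable M (\<lambda>\<omega>. (norm (w 0 \<omega>))\<^sup>2)"
    and "U_max > 0" and "0 < phi_max" and "phi_max \<le> U_max"
    and "N \<ge> 1"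
    and "\<forall>k\<le>N. sym_pos_def (Q k)" and "\<forall>k<N. sym_pos_def (R k)"
    and "\<forall>i<N. \<forall>j s. \<bar>phi i j s\<bar> \<le> phi_max"
    and "schur_stable A"
    and "\<forall>i<N. \<forall>j. (\<integral>y. phi i j ((F *v y) $ j) \<partial>(distr M borel (w 0))) = 0"
    and "\<forall>x. fh_optimal A B F r Q R phi phi_max U_max N (distr M borel (w 0)) x
                (fst (opt x)) (snd (opt x))"
  shows "(SUP t. \<integral>\<^sup>+ \<omega>. ennreal ((norm (mpc_cl A B F r (\<lambda>x. snd (opt x) 0) x0 w t \<omega>))\<^sup>2) \<partial>M)
           < \<infinity>"
proof -
  interpret prob_space M by (fact assms(1))
  have "fh_admissible phi_max U_max N (fst (opt x)) (snd (opt x))" for x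
    using spec[OF assms(14), of x] unfolding fh_optimal_def by (rule conjunct1)
  then have input: "norm (snd (opt x) 0) \<le> CARD('m) * U_max" for x
    by (rule fh_admissible_first_input_norm_le) (use assms(8) in simp)
  have w: "w t \<in> borel_measurable M" for t
    using assms(2) by (auto simp: indep_vars_def)
  have w_distr: "distr M borel (w t) = distr M borel (w 0)" for t
    using assms(3) by blast
  show ?thesis
    by (rule mpc_cl_second_moment_bounded[where pol="\<lambda>x. snd (opt x) 0" and w=w,
        OF assms(1,12) input w w_distr assms(4)])
qed

end
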